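(* Let $m\geq 5$, $2\leq\ell\leq m/2$ and $0\leq R\leq (m-\ell)/(\ell-1)$ be integers, and put $$A:=\{0,1,m-\ell+1,m-\ell+2,\ldots,m\},\qquad t:=\binom{\ell+R}{R},\qquad g:=(R+1)(m-\ell+1)-1.$$ Then: (i) For $H:=2R+1$, $(HA)^{(t)}\neq [Hm]\setminus\big(\mathcal{E}_t(A)\cup(Hm-\mathcal{E}_t(m-A))\big)$. (ii) If $h>2R+1$ is an integer and $(hA)^{(t)}=[hm]\setminus\big(\mathcal{E}_t(A)\cup(hm-\mathcal{E}_t(m-A))\big)$, then $h\geq g=(R+1)(m-\ell+1)-1$.
   Context: For an integer $N\ge 0$, $[N]:=\{0,1,\ldots,N\}$. For a set $X$ of integers and an integer $N$, $N-X:=\{N-x : x\in X\}$. For a finite set $A$ of non-negative integers with $\min A=0$, maximum $m$ and $\gcd(A)=1$, and integers $h,t\geq 1$, $r_{A,h}(n)$ is the number of $(k_a)_{a\in A}\in\mathbb{Z}_{\geq 0}^{A}$ with $\sum_{a\in A}k_a a=n$ and $\sum_{a\in A}k_a=h$; $(hA)^{(t)}:=\{n\in\mathbb{Z}_{\geq 0} : r_{A,h}(n)\geq t\}$; $\mathcal{P}_t(A):=\bigcup_{h\geq 1}(hA)^{(t)}$; $\mathcal{E}_t(A):=\mathbb{Z}_{\geq 0}\setminus\mathcal{P}_t(A)$. The same definitions are applied to $m-A$. *)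

theory Defs
  imports Complex_Main "HOL-Library.FuncSet"
begin

text \<open>
  Sets of integers are kept as \<open>int set\<close>, so that \<open>N - X\<close> is a genuine integer reflection:
  it may contain negative numbers, which truncated subtraction on \<open>nat\<close> would send to \<open>0\<close>.
  The intended use is for finite sets \<open>A\<close> of non-negative integers with \<open>Min A = 0\<close> and
  \<open>Gcd A = 1\<close>, and for \<open>h, t \<ge> 1\<close>.
  The definitions below are, in order, \<open>N - X\<close>, \<open>r\<^sub>A\<^sub>,\<^sub>h(n)\<close>, \<open>(hA)\<^sup>(\<^sup>t\<^sup>)\<close>, \<open>P\<^sub>t(A)\<close> and \<open>E\<^sub>t(A)\<close>.
\<close>

definition reflect :: "int \<Rightarrow> int set \<Rightarrow> int set" where
  "reflect N X = {N - x | x. x \<in> X}"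

text \<open>The tuples \<open>(k\<^sub>a)\<close> are extensional functions on \<open>A\<close>, so each one is counted once.\<close>

definition rep_count :: "int set \<Rightarrow> nat \<Rightarrow> int \<Rightarrow> nat" where
  "rep_count A h n =
     card {k \<in> A \<rightarrow>\<^sub>E (UNIV :: nat set). (\<Sum>a\<in>A. int (k a) * a) = n \<and> (\<Sum>a\<in>A. k a) = h}"

definition popular_sumset :: "nat \<Rightarrow> nat \<Rightarrow> int set \<Rightarrow> int set" where
  "popular_sumset t h A = {n. 0 \<le> n \<and> t \<le> rep_count A h n}"

definition popular_set :: "nat \<Rightarrow> int set \<Rightarrow> int set" where
  "popular_set t A = (\<Union>h\<in>{1..}. popular_sumset t h A)"

definition exceptional_set :: "nat \<Rightarrow> int set \<Rightarrow> int set" where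
  "exceptional_set t A = {0..} - popular_set t A"

end

theory Submission
  imports Defs
begin

text \<open>
  Call the elements of \<open>A\<close> other than \<open>0\<close> and \<open>1\<close> \<^emph>\<open>large\<close>. A representation of \<open>n\<close> as a sum of
  \<open>h\<close> elements of \<open>A\<close> is determined by the multiplicities of its large parts: the number of ones
  makes up the value \<open>n\<close>, and then the number of zeros makes up the length \<open>h\<close>
  (lemma \<open>rep_count_eq_card_large_parts\<close>). So everything reduces to counting multisets of large
  parts, and \<open>t\<close>, the binomial coefficient \<open>l + R\<close> over \<open>R\<close>, is the number of multisets of at most
  \<open>R\<close> parts taken from \<open>l\<close> values.

  Both \<open>A\<close> and \<open>m - A\<close> contain \<open>0\<close> and \<open>1\<close> and have exactly \<open>l\<close> large elements, all at most \<open>m\<close>.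
  Every multiset of at most \<open>R\<close> large parts therefore has sum at most \<open>R m\<close>, so no \<open>n \<ge> R m\<close> is
  exceptional for either set (lemma \<open>in_popular_set_if_large\<close>).

  The obstruction is the single number \<open>g = (R + 1) (m - l + 1) - 1\<close>. It is smaller
  than any sum of \<open>R + 1\<close> large parts of \<open>A\<close>, so every representation of \<open>g\<close> has at most \<open>R\<close>
  large parts and there are at most \<open>t\<close> of them. Reaching \<open>t\<close> requires each multiset to occur,
  including the empty one, which stands for \<open>g = 1 + \<dots> + 1\<close> and needs \<open>h \<ge> g\<close> summands (lemma
  \<open>rep_count_less_if_short\<close>). On the other hand the bound on \<open>R\<close> says precisely that
  \<open>g \<ge> R m\<close>, and \<open>h m - g \<ge> R m\<close> as soon as \<open>h \<ge> 2 R + 1\<close>; so \<open>g\<close> belongs to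
  the set of all numbers up to \<open>h m\<close> that are exceptional from neither side. Equality hence forces
  \<open>h \<ge> g\<close> for every \<open>h \<ge> 2 R + 1\<close>, which is the second claim; the first follows because
  \<open>2 R + 1 < g\<close>.
\<close>

section \<open>Multisets of bounded size\<close>

definition bounded_multiplicities :: "'a set \<Rightarrow> nat \<Rightarrow> ('a \<Rightarrow> nat) set" where
  "bounded_multiplicities D R = {f \<in> D \<rightarrow>\<^sub>E UNIV. sum f D \<le> R}"

lemma bounded_multiplicities_insert:
  assumes "finite D" "x \<notin> D"
  shows "bounded_multiplicities (insert x D) R =
    (\<lambda>(j, f). f(x := j)) ` (SIGMA j:{..R}. bounded_multiplicities D (R - j))"
proof -
  have upd: "sum (f(x := j)) (insert x D) = j + sum f D" for f and j :: nat
    using assms by (auto intro!: sum.cong)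
  show ?thesis
  proof (intro equalityI subsetI)
    fix k assume k: "k \<in> bounded_multiplicities (insert x D) R"
    then obtain j f where jf: "k = f(x := j)" "f \<in> D \<rightarrow>\<^sub>E (UNIV :: nat set)"
      unfolding bounded_multiplicities_def PiE_insert_eq by auto
    with k upd[of f j] have "j + sum f D \<le> R"
      by (simp add: bounded_multiplicities_def)
    with jf show "k \<in> (\<lambda>(j, f). f(x := j)) ` (SIGMA j:{..R}. bounded_multiplicities D (R - j))"
      by (intro image_eqI[of _ _ "(j, f)"]) (auto simp: bounded_multiplicities_def)
  next
    fix k assume "k \<in> (\<lambda>(j, f). f(x := j)) ` (SIGMA j:{..R}. bounded_multiplicities D (R - j))"
    then obtain j f where "k = f(x := j)" "f \<in> D \<rightarrow>\<^sub>E UNIV" "j \<le> R" "sum f D \<le> R - j"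
      by (auto simp: bounded_multiplicities_def)
    with upd[of f j] show "k \<in> bounded_multiplicities (insert x D) R"
      unfolding bounded_multiplicities_def PiE_insert_eq by auto
  qed
qed

text \<open>
  Splitting off the multiplicity \<open>j\<close> of one element turns the count into a sum over \<open>j\<close> of counts
  for the remaining elements, which is the hockey-stick identity.
\<close>

lemma finite_card_bounded_multiplicities:
  assumes "finite D"
  shows "finite (bounded_multiplicities D R) \<and>
         card (bounded_multiplicities D R) = (card D + R) choose R"
  using assms
proof (induction D arbitrary: R rule: finite_induct)
  case empty
  show ?case by (simp add: bounded_multiplicities_def)
next
  case (insert x D)
  let ?S = "SIGMA j:{..R}. bounded_multiplicities D (R - j)"
  have inj: "inj_on (\<lambda>(j, f). f(x := j)) ?S"
    by (rule inj_on_subset[OF inj_combinator[OF insert.hyps(2), of "\<lambda>_. UNIV"]])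
       (auto simp: bounded_multiplicities_def)
  have fin: "finite ?S"
    using insert.IH by (intro finite_SigmaI) auto
  have "card ?S = (\<Sum>j\<le>R. (card D + (R - j)) choose (R - j))"
    using insert.IH by simp
  also have "\<dots> = (\<Sum>i\<le>R. (card D + i) choose i)"
    by (rule sum.reindex_bij_witness[of _ "\<lambda>i. R - i" "\<lambda>j. R - j"]) auto
  also have "\<dots> = (card (insert x D) + R) choose R"
    using sum_choose_lower[of "card D" R] insert.hyps by simp
  finally show ?case
    using bounded_multiplicities_insert[OF insert.hyps] inj fin by (simp add: card_image)
qed

section \<open>Representations and their large parts\<close>

text \<open>
  The two inequalities on the right say that the number of ones, \<open>n - \<Sum> f(a) a\<close>, and the number
  of zeros, \<open>h - \<Sum> f(a)\<close> minus the number of ones, are nonnegative.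
\<close>

lemma rep_count_eq_card_large_parts:
  fixes A :: "int set"
  assumes fin: "finite A" and "0 \<in> A" "1 \<in> A" and D: "D = A - {0, 1}"
  shows "rep_count A h n =
    card {f \<in> D \<rightarrow>\<^sub>E (UNIV :: nat set). (\<Sum>a\<in>D. int (f a) * a) \<le> n \<and>
            n + int (sum f D) \<le> int h + (\<Sum>a\<in>D. int (f a) * a)}"
    (is "_ = card ?F")
proof -
  let ?K = "{k \<in> A \<rightarrow>\<^sub>E (UNIV :: nat set). (\<Sum>a\<in>A. int (k a) * a) = n \<and> (\<Sum>a\<in>A. k a) = h}"
  define fill where "fill f = (let u = nat (n - (\<Sum>a\<in>D. int (f a) * a)) in
    f(1 := u, 0 := h - u - sum f D))" for f :: "int \<Rightarrow> nat"
  have A: "A = insert 0 (insert 1 D)" "0 \<notin> D" "1 \<notin> D" "finite D"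
    using assms by auto
  have sums: "(\<Sum>a\<in>A. int (k a) * a) = int (k 1) + (\<Sum>a\<in>D. int (k a) * a)"
    "(\<Sum>a\<in>A. k a) = k 0 + k 1 + sum k D" for k
    using A by simp_all
  have on_D: "(\<Sum>a\<in>D. int (fill f a) * a) = (\<Sum>a\<in>D. int (f a) * a)" "sum (fill f) D = sum f D" for f
    using A by (auto intro!: sum.cong simp: fill_def Let_def)
  have res: "(\<Sum>a\<in>D. int (restrict k D a) * a) = (\<Sum>a\<in>D. int (k a) * a)"
    "sum (restrict k D) D = sum k D" for k
    by simp_all
  have "bij_betw (\<lambda>k. restrict k D) ?K ?F"
  proof (rule bij_betw_byWitness[where f' = fill])
    show "\<forall>k\<in>?K. fill (restrict k D) = k"
    proof
      fix k assume k: "k \<in> ?K"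
      then have "k 1 = nat (n - (\<Sum>a\<in>D. int (k a) * a))" "k 0 = h - k 1 - sum k D"
        using sums[of k] by auto
      moreover have "k a = undefined" if "a \<notin> A" for a
        using k that by (auto simp: PiE_iff extensional_def)
      ultimately show "fill (restrict k D) = k"
        using A(1) by (auto simp: fill_def Let_def fun_eq_iff)
    qed
    show "\<forall>f\<in>?F. restrict (fill f) D = f"
      using A by (auto simp: fill_def Let_def fun_eq_iff PiE_iff extensional_def)
    show "(\<lambda>k. restrict k D) ` ?K \<subseteq> ?F"
      using sums by auto
    show "fill ` ?F \<subseteq> ?K"
    proof safe
      fix f :: "int \<Rightarrow> nat"
      assume f: "f \<in> D \<rightarrow>\<^sub>E UNIV" "(\<Sum>a\<in>D. int (f a) * a) \<le> n"
        "n + int (sum f D) \<le> int h + (\<Sum>a\<in>D. int (f a) * a)"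
      show "(\<Sum>a\<in>A. int (fill f a) * a) = n" "sum (fill f) A = h"
        using f unfolding sums on_D by (auto simp: fill_def Let_def simp del: of_nat_sum)
    next
      fix f :: "int \<Rightarrow> nat" and a
      assume "f \<in> D \<rightarrow>\<^sub>E UNIV" "a \<notin> A"
      then show "fill f a = undefined"
        using A(1) by (auto simp: fill_def Let_def PiE_iff extensional_def)
    qed simp
  qed
  then show ?thesis
    unfolding rep_count_def by (rule bij_betw_same_card)
qed

text \<open>
  Each multiset of at most \<open>R\<close> large parts has sum at most \<open>R m \<le> n\<close>, so it extends to a
  representation of \<open>n\<close> once \<open>h\<close> is so large that the length is no constraint.
\<close>

lemma in_popular_set_if_large:
  fixes A :: "int set"
  assumes fin: "finite A" and "0 \<in> A" "1 \<in> A" and sub: "A \<subseteq> {0..int m}"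
    and n: "int R * int m \<le> n"
  shows "n \<in> popular_set ((card (A - {0, 1}) + R) choose R) A"
proof -
  define D where "D = A - {0, 1}"
  define h where "h = nat n + R + 1"
  have "finite D" using fin by (simp add: D_def)
  have n0: "0 \<le> n" using n by (smt (verit) of_nat_0_le_iff mult_nonneg_nonneg)
  let ?F = "{f \<in> D \<rightarrow>\<^sub>E (UNIV :: nat set). (\<Sum>a\<in>D. int (f a) * a) \<le> n \<and>
            n + int (sum f D) \<le> int h + (\<Sum>a\<in>D. int (f a) * a)}"
  have sub_F: "bounded_multiplicities D R \<subseteq> ?F"
  proof
    fix f assume f: "f \<in> bounded_multiplicities D R"
    then have "sum f D \<le> R" by (simp add: bounded_multiplicities_def)
    have "(\<Sum>a\<in>D. int (f a) * a) \<le> (\<Sum>a\<in>D. int (f a) * int m)"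
      using sub by (intro sum_mono mult_left_mono) (auto simp: D_def)
    also have "\<dots> = int (sum f D) * int m"
      by (simp add: sum_distrib_right)
    also have "\<dots> \<le> int R * int m"
      using \<open>sum f D \<le> R\<close> by (intro mult_right_mono) (auto simp del: of_nat_sum)
    finally have "(\<Sum>a\<in>D. int (f a) * a) \<le> n" using n by simp
    moreover have "0 \<le> (\<Sum>a\<in>D. int (f a) * a)"
      using sub by (intro sum_nonneg) (auto simp: D_def)
    then have "n + int (sum f D) \<le> int h + (\<Sum>a\<in>D. int (f a) * a)"
      using n0 \<open>sum f D \<le> R\<close> unfolding h_def by linarith
    ultimately show "f \<in> ?F"
      using f by (simp add: bounded_multiplicities_def)
  qed
  have "finite ?F"
  proof (rule finite_subset)
    show "?F \<subseteq> bounded_multiplicities D (h + nat n)"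
      using n0 by (auto simp: bounded_multiplicities_def simp del: of_nat_sum)
    show "finite (bounded_multiplicities D (h + nat n))"
      using finite_card_bounded_multiplicities \<open>finite D\<close> by blast
  qed
  then have "card (bounded_multiplicities D R) \<le> rep_count A h n"
    unfolding rep_count_eq_card_large_parts[OF assms(1-3) D_def]
    using sub_F by (rule card_mono)
  then have "n \<in> popular_sumset ((card D + R) choose R) h A"
    using n0 finite_card_bounded_multiplicities[OF \<open>finite D\<close>, of R]
    by (simp add: popular_sumset_def)
  moreover have "h \<in> {1..}" by (simp add: h_def)
  ultimately show ?thesis
    unfolding popular_set_def D_def by blast
qed

text \<open>
  A value below \<open>(R + 1) d\<close> leaves room for at most \<open>R\<close> large parts, and with fewer than \<open>n\<close>
  summands the empty multiset of large parts is lost.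
\<close>

lemma rep_count_less_if_short:
  fixes A :: "int set"
  assumes fin: "finite A" and "0 \<in> A" "1 \<in> A"
    and large: "\<And>a. a \<in> A - {0, 1} \<Longrightarrow> d \<le> a" and "0 < d"
    and n: "n < (int R + 1) * d" and short: "int h < n"
  shows "rep_count A h n < (card (A - {0, 1}) + R) choose R"
proof -
  define D where "D = A - {0, 1}"
  define z where "z = restrict (\<lambda>_. 0 :: nat) D"
  have "finite D" using fin by (simp add: D_def)
  note mult = finite_card_bounded_multiplicities[OF this, of R]
  let ?F = "{f \<in> D \<rightarrow>\<^sub>E (UNIV :: nat set). (\<Sum>a\<in>D. int (f a) * a) \<le> n \<and>
            n + int (sum f D) \<le> int h + (\<Sum>a\<in>D. int (f a) * a)}"
  have "?F \<subseteq> bounded_multiplicities D R"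
  proof
    fix f assume f: "f \<in> ?F"
    have "int (sum f D) * d = (\<Sum>a\<in>D. int (f a) * d)"
      by (simp add: sum_distrib_right)
    also have "\<dots> \<le> (\<Sum>a\<in>D. int (f a) * a)"
      using large by (intro sum_mono mult_left_mono) (auto simp: D_def)
    also have "\<dots> < (int R + 1) * d" using f n by simp
    finally have "int (sum f D) < int R + 1"
      using \<open>0 < d\<close> by (simp add: mult_less_cancel_right)
    then show "f \<in> bounded_multiplicities D R"
      using f by (simp add: bounded_multiplicities_def del: of_nat_sum)
  qed
  moreover have "z \<in> bounded_multiplicities D R"
    by (simp add: bounded_multiplicities_def z_def)
  moreover have "z \<notin> ?F"
    using short by (simp add: z_def)
  ultimately have "?F \<subset> bounded_multiplicities D R" by blast
  then have "card ?F < card (bounded_multiplicities D R)"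
    using mult by (intro psubset_card_mono) auto
  then show ?thesis
    unfolding rep_count_eq_card_large_parts[OF assms(1-3) D_def]
    using mult by (simp add: D_def)
qed

section \<open>The critical value\<close>

theorem proposition4p4:
  fixes m l R t :: nat and g :: int and A :: "int set"
  assumes "5 \<le> m"
    and "2 \<le> l" and "real l \<le> real m / 2"
    and "real R \<le> (real m - real l) / (real l - 1)"
    and "A = {0, 1} \<union> {int m - int l + 1 .. int m}"
    and "t = (l + R) choose R"
    and "g = (int R + 1) * (int m - int l + 1) - 1"
  shows "(\<forall>H :: nat. H = 2 * R + 1 \<longrightarrow>
           popular_sumset t H A \<noteq>
             {0 .. int H * int m} -
               (exceptional_set t A \<union>
                reflect (int H * int m) (exceptional_set t (reflect (int m) A)))) \<and>
         (\<forall>h :: nat. h > 2 * R + 1 \<longrightarrow>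
           popular_sumset t h A =
             {0 .. int h * int m} -
               (exceptional_set t A \<union>
                reflect (int h * int m) (exceptional_set t (reflect (int m) A))) \<longrightarrow>
           int h \<ge> g)"
proof -
  define B where "B = reflect (int m) A"
  define d where "d = int m - int l + 1"
  have lm: "2 * int l \<le> int m" using assms(3) by linarith
  have d3: "3 \<le> d" using lm \<open>5 \<le> m\<close> by (simp add: d_def)
  have "real R * (real l - 1) \<le> real m - real l"
    using assms(2,4) by (simp add: pos_le_divide_eq)
  then have "real_of_int (int R * (int l - 1)) \<le> real_of_int (int m - int l)"
    by simp
  then have R: "int R * (int l - 1) \<le> int m - int l"
    by linarith
  have g: "g = (int R + 1) * d - 1" by (simp add: assms(7) d_def)

  have large_A: "A - {0, 1} = {d..int m}"
    using d3 by (auto simp: assms(5) d_def)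
  have A: "finite A" "0 \<in> A" "1 \<in> A" "A \<subseteq> {0..int m}" "card (A - {0, 1}) = l"
    unfolding large_A using assms(1,2) lm by (auto simp: assms(5) d_def)
  have B_eq: "B = {0..int l - 1} \<union> {int m - 1, int m}"
  proof -
    have "B = (\<lambda>x. int m - x) ` A" by (auto simp: B_def reflect_def)
    also have "\<dots> = (\<lambda>x. int m - x) ` {0, 1} \<union> (\<lambda>x. int m - x) ` {d..int m}"
      by (simp add: assms(5) d_def image_Un)
    also have "(\<lambda>x. int m - x) ` {d..int m} = {0..int l - 1}"
      by (simp add: image_diff_atLeastAtMost d_def)
    finally show ?thesis by auto
  qed
  have large_B: "B - {0, 1} = {2..int l - 1} \<union> {int m - 1, int m}"
    using assms(1,2) by (auto simp: B_eq)
  have B: "finite B" "0 \<in> B" "1 \<in> B" "B \<subseteq> {0..int m}"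
    using assms(1,2) lm by (auto simp: B_eq)
  have "card (B - {0, 1}) = card {2..int l - 1} + card {int m - 1, int m}"
    unfolding large_B using assms(2) lm by (intro card_Un_disjoint) auto
  then have card_B: "card (B - {0, 1}) = l"
    using assms(2) by simp

  have pop_A: "n \<notin> exceptional_set t A" if "int R * int m \<le> n" for n
    using in_popular_set_if_large[OF A(1-4) that] A(5) assms(6)
    by (simp add: exceptional_set_def)
  have pop_B: "n \<notin> exceptional_set t B" if "int R * int m \<le> n" for n
    using in_popular_set_if_large[OF B that] card_B assms(6)
    by (simp add: exceptional_set_def)

  have g_large: "int R * int m \<le> g"
    using R by (simp add: assms(7) algebra_simps)
  have main: "g \<le> int h"
    if h: "2 * R + 1 \<le> h"
      and eq: "popular_sumset t h A = {0..int h * int m} -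
        (exceptional_set t A \<union> reflect (int h * int m) (exceptional_set t B))" for h
  proof (rule ccontr)
    assume "\<not> g \<le> int h"
    then have "rep_count A h g < t"
      using rep_count_less_if_short[OF A(1-3), of d g R h] d3 large_A A(5) assms(6) g by simp
    then have "g \<notin> popular_sumset t h A"
      by (simp add: popular_sumset_def)
    moreover have "g \<in> {0..int h * int m} -
        (exceptional_set t A \<union> reflect (int h * int m) (exceptional_set t B))"
    proof -
      have "(2 * int R + 1) * int m \<le> int h * int m"
        using h by (intro mult_right_mono) auto
      \<comment> \<open>Since \<open>(R + 1) d \<le> (R + 1) m\<close>, at least \<open>R m\<close> remains after subtracting \<open>g\<close>.\<close>
      moreover have "(int R + 1) * d \<le> (int R + 1) * int m"
        using assms(2) by (intro mult_left_mono) (auto simp: d_def)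
      ultimately have refl_large: "int R * int m \<le> int h * int m - g"
        by (simp add: g algebra_simps)
      have "0 \<le> int R * int m" by simp
      with refl_large g_large have "0 \<le> g" "g \<le> int h * int m" by linarith+
      then show ?thesis
        using pop_A[OF g_large] pop_B[OF refl_large] by (auto simp: reflect_def)
    qed
    ultimately show False using eq by simp
  qed
  have "(int R + 1) * 3 \<le> (int R + 1) * d"
    using d3 by (intro mult_left_mono) auto
  then have short: "int (2 * R + 1) < g"
    by (simp add: g)
  show ?thesis
    using main[of "2 * R + 1"] main short unfolding B_def by fastforce
qed

end
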